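(* Let $\alpha,\beta\in(0,1/2)$, and consider the distributed sequential test described in the context. Let $k=Nr^2$ and suppose that for each $i=1,\dots,N$ the thresholds satisfy $$\gamma_{d,i}^{h}\ \ge\ \frac{8(k+1)}{7N}\left(\log\left(\frac{2}{\alpha}\right)-\log\left(1-e^{-\frac{Nm}{4(k+1)}}\right)\right),\qquad \gamma_{d,i}^{l}\ \le\ \frac{8(k+1)}{7N}\left(\log\left(\frac{\beta}{2}\right)+\log\left(1-e^{-\frac{Nm}{4(k+1)}}\right)\right).$$ Then $$\limsup_{t\to\infty}\frac1t\log\big(\mathbb{P}_1(T_{d,i}>t)\big)\le-\frac{Nm}{4},\qquad\forall i=1,2,\dots,N.$$
   Context: Observation model: there are $N$ agents; at each time $t=1,2,\dots$ agent $i$ observes $y_i(t)=\mu_\theta+n_i(t)$ under hypothesis $H_\theta$, $\theta\in\{0,1\}$, with $\mu_1=\mu$, $\mu_0=-\mu$, $\mu\neq 0$. The noises $n_i(t)$ are independent over all agents $i$ and times $t$, each Gaussian with mean $0$ and variance $\sigma^2>0$, under both hypotheses. $\mathbb{P}_\theta$ denotes probability under $H_\theta$. The log-likelihood ratio at agent $i$ is $\eta_i(t)=2\mu y_i(t)/\sigma^2$, and $\boldsymbol\eta(t)=(\eta_1(t),\dots,\eta_N(t))^\top$. Put $m=2\mu^2/\sigma^2$; thus $\eta_i(t)\sim\mathcal N(m,2m)$ under $H_1$ and $\mathcal N(-m,2m)$ under $H_0$ (mean, variance). Network: $G=(V,E)$ is a connected simple undirected graph on the agents $V=\{1,\dots,N\}$.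 $\mathbf W=[w_{ij}]$ is an $N\times N$ non-negative, symmetric, irreducible, stochastic (rows sum to one) matrix with $w_{ij}=0$ whenever $i\ne j$ and $(i,j)\notin E$. Let $\mathbf J=\frac1N\mathbf 1\mathbf 1^\top$ and $r=\|\mathbf W-\mathbf J\|$ (induced $\mathcal L_2$ norm), and assume $r<1$. Test: the vector of agent statistics $\mathbf S_d(t)=(S_{d,1}(t),\dots,S_{d,N}(t))^\top$ is given by $\mathbf S_d(0)=\mathbf 0$ and $\mathbf S_d(t+1)=\mathbf W(\mathbf S_d(t)+\boldsymbol\eta(t+1))$, i.e. $S_{d,i}(t)=\sum_{j=1}^t\mathbf e_i^\top\mathbf W^{t+1-j}\boldsymbol\eta(j)$. Given thresholds $\gamma_{d,i}^l,\gamma_{d,i}^h\in\mathbb R$, the stopping time of agent $i$ is $T_{d,i}=\inf\{t\ge1: S_{d,i}(t)\notin[\gamma_{d,i}^l,\gamma_{d,i}^h]\}$. $\log$ is the natural logarithm (with $\log 0=-\infty$). *)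

theory Defs
  imports "HOL-Probability.Probability"
begin

definition hyp_mean :: "real \<Rightarrow> nat \<Rightarrow> real" where
  "hyp_mean \<mu> \<theta> = (if \<theta> = 1 then \<mu> else - \<mu>)"

text \<open>Both hypotheses live on one measurable space and share the observations \<open>y i t\<close>; only the
  measure \<open>P \<theta>\<close> changes, for \<open>\<theta>\<close> in \<open>{0, 1}\<close>. The noise under \<open>H\<^sub>\<theta>\<close> is therefore
  \<open>y i t - \<mu>\<^sub>\<theta>\<close>. Observation times start at 1.\<close>

definition gaussian_observations ::
  "(nat \<Rightarrow> 'a measure) \<Rightarrow> real \<Rightarrow> real \<Rightarrow> ('n::finite \<Rightarrow> nat \<Rightarrow> 'a \<Rightarrow> real) \<Rightarrow> bool" where
  "gaussian_observations P \<mu> \<sigma> y \<longleftrightarrow>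
     sets (P 0) = sets (P 1) \<and>
     (\<forall>\<theta>\<in>{0, 1}.
        prob_space (P \<theta>) \<and>
        prob_space.indep_vars (P \<theta>) (\<lambda>_. borel)
          (\<lambda>(i, t) \<omega>. y i t \<omega> - hyp_mean \<mu> \<theta>) (UNIV \<times> {1..}) \<and>
        (\<forall>i. \<forall>t\<ge>1. distributed (P \<theta>) lborel
          (\<lambda>\<omega>. y i t \<omega> - hyp_mean \<mu> \<theta>) (\<lambda>x. ennreal (normal_density 0 \<sigma> x))))"

definition connected_simple_graph :: "('n \<times> 'n) set \<Rightarrow> bool" where
  "connected_simple_graph E \<longleftrightarrow> sym E \<and> irrefl E \<and> (\<forall>i j. (i, j) \<in> E\<^sup>*)"

text \<open>No simultaneous permutation of rows and columns brings the matrix into block triangular form;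
  \<open>S\<close> is the index set of the diagonal block whose rows vanish outside that block.\<close>

definition irreducible_matrix :: "real^'n^'n \<Rightarrow> bool" where
  "irreducible_matrix W \<longleftrightarrow>
     \<not> (\<exists>S. S \<noteq> {} \<and> S \<noteq> UNIV \<and> (\<forall>i\<in>S. \<forall>j\<in>- S. W $ i $ j = 0))"

definition consensus_weights :: "('n::finite \<times> 'n) set \<Rightarrow> real^'n^'n \<Rightarrow> bool" where
  "consensus_weights E W \<longleftrightarrow>
     (\<forall>i j. 0 \<le> W $ i $ j) \<and>
     transpose W = W \<and>
     irreducible_matrix W \<and>
     (\<forall>i. (\<Sum>j\<in>UNIV. W $ i $ j) = 1) \<and>
     (\<forall>i j. i \<noteq> j \<longrightarrow> (i, j) \<notin> E \<longrightarrow> W $ i $ j = 0)"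

definition averaging_matrix :: "real^'n^'n::finite" where
  "averaging_matrix = (\<chi> i j. 1 / real CARD('n))"

definition llr :: "real \<Rightarrow> real \<Rightarrow> ('n::finite \<Rightarrow> nat \<Rightarrow> 'a \<Rightarrow> real) \<Rightarrow> nat \<Rightarrow> 'a \<Rightarrow> real^'n" where
  "llr \<mu> \<sigma> y t \<omega> = (\<chi> i. 2 * \<mu> * y i t \<omega> / \<sigma>\<^sup>2)"

primrec dist_stat ::
  "real^'n^'n::finite \<Rightarrow> (nat \<Rightarrow> 'a \<Rightarrow> real^'n) \<Rightarrow> nat \<Rightarrow> 'a \<Rightarrow> real^'n" where
  "dist_stat W \<eta> 0 \<omega> = 0"
| "dist_stat W \<eta> (Suc t) \<omega> = W *v (dist_stat W \<eta> t \<omega> + \<eta> (Suc t) \<omega>)"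

text \<open>Infimum in \<open>enat\<close>, so the value is \<open>\<infinity>\<close> if the statistic never leaves the interval.\<close>

definition agent_stopping_time ::
  "(nat \<Rightarrow> 'a \<Rightarrow> real^'n::finite) \<Rightarrow> ('n \<Rightarrow> real) \<Rightarrow> ('n \<Rightarrow> real) \<Rightarrow> 'n \<Rightarrow> 'a \<Rightarrow> enat" where
  "agent_stopping_time S \<gamma>l \<gamma>h i \<omega> = Inf {enat t | t. 1 \<le> t \<and> S t \<omega> $ i \<notin> {\<gamma>l i..\<gamma>h i}}"

text \<open>Needed because \<open>ln 0 = 0\<close> on the reals. Only applied to non-negative arguments.\<close>

definition elog :: "real \<Rightarrow> ereal" where
  "elog x = (if x \<le> 0 then - \<infinity> else ereal (ln x))"

end

theory Submission
  imports Defs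
begin

text \<open>If agent \<open>i\<close> has not stopped by time \<open>t\<close>, then \<open>S\<^sub>i(t) \<le> \<gamma>h i\<close>. Expanding the recursion,
  \<open>S\<^sub>i(t)\<close> is the sum of the inner products of \<open>u\<^sub>n = W\<^sup>n e\<^sub>i\<close>, \<open>n = 1, \<dots>, t\<close>, with independent
  Gaussian vectors. The entries of \<open>u\<^sub>n\<close> sum to one, and \<open>u\<^sub>n\<close> approaches the vector with entries
  \<open>1/N\<close> at the geometric rate \<open>r\<^sup>n\<close>, so under \<open>H\<^sub>1\<close> the mean of \<open>S\<^sub>i(t)\<close> is \<open>m t\<close> and its variance
  exceeds \<open>2 m t / N\<close> by at most a constant. The Chernoff bound with exponent \<open>- N/2\<close> then gives
  \<open>P\<^sub>1(T > t) \<le> exp (C - N m t / 4)\<close>.\<close>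

section \<open>Exponential moments and tail bounds for Gaussian sums\<close>

text \<open>Completing the square: weighting the density by \<open>exp (a * x)\<close> shifts its
  mean by \<open>a * \<sigma>\<^sup>2\<close> and multiplies it by a constant, and the shifted
  density still integrates to one.\<close>

lemma nn_integral_exp_normal:
  fixes \<mu> \<sigma> a :: real
  assumes "distributed M lborel X (\<lambda>x. ennreal (normal_density \<mu> \<sigma> x))" and "\<sigma> > 0"
  shows "(\<integral>\<^sup>+\<omega>. ennreal (exp (a * X \<omega>)) \<partial>M) = ennreal (exp (a * \<mu> + a\<^sup>2 * \<sigma>\<^sup>2 / 2))"
proof -
  have shift: "normal_density \<mu> \<sigma> x * exp (a * x) =
      exp (a * \<mu> + a\<^sup>2 * \<sigma>\<^sup>2 / 2) * normal_density (\<mu> + a * \<sigma>\<^sup>2) \<sigma> x" for x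
  proof -
    have "- (x - \<mu>)\<^sup>2 / (2 * \<sigma>\<^sup>2) + a * x =
        a * \<mu> + a\<^sup>2 * \<sigma>\<^sup>2 / 2 + - (x - (\<mu> + a * \<sigma>\<^sup>2))\<^sup>2 / (2 * \<sigma>\<^sup>2)"
      using assms(2) by (simp add: field_simps power2_eq_square)
    then have "exp (- (x - \<mu>)\<^sup>2 / (2 * \<sigma>\<^sup>2)) * exp (a * x) =
        exp (a * \<mu> + a\<^sup>2 * \<sigma>\<^sup>2 / 2) * exp (- (x - (\<mu> + a * \<sigma>\<^sup>2))\<^sup>2 / (2 * \<sigma>\<^sup>2))"
      by (metis exp_add)
    then show ?thesis
      by (simp add: normal_density_def)
  qed
  have "(\<integral>\<^sup>+\<omega>. ennreal (exp (a * X \<omega>)) \<partial>M) =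
      (\<integral>\<^sup>+x. ennreal (normal_density \<mu> \<sigma> x) * ennreal (exp (a * x)) \<partial>lborel)"
    by (rule distributed_nn_integral[OF assms(1), symmetric]) measurable
  also have "\<dots> = (\<integral>\<^sup>+x. ennreal (exp (a * \<mu> + a\<^sup>2 * \<sigma>\<^sup>2 / 2)) *
      ennreal (normal_density (\<mu> + a * \<sigma>\<^sup>2) \<sigma> x) \<partial>lborel)"
    by (simp add: ennreal_mult[symmetric] shift)
  also have "\<dots> = ennreal (exp (a * \<mu> + a\<^sup>2 * \<sigma>\<^sup>2 / 2)) *
      (\<integral>\<^sup>+x. ennreal (normal_density (\<mu> + a * \<sigma>\<^sup>2) \<sigma> x) \<partial>lborel)"
    by (rule nn_integral_cmult) measurable
  also have "(\<integral>\<^sup>+x. ennreal (normal_density (\<mu> + a * \<sigma>\<^sup>2) \<sigma> x) \<partial>lborel) = 1"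
    using assms(2) by (subst nn_integral_eq_integral) auto
  finally show ?thesis by simp
qed

lemma (in prob_space) nn_integral_exp_sum_indep_normal:
  fixes \<sigma> :: real and a :: "'i \<Rightarrow> real"
  assumes "finite I" and ind: "indep_vars (\<lambda>_. borel) X I" and "\<sigma> > 0"
    and "\<And>j. j \<in> I \<Longrightarrow> distributed M lborel (X j) (\<lambda>x. ennreal (normal_density 0 \<sigma> x))"
  shows "(\<integral>\<^sup>+\<omega>. ennreal (exp (\<Sum>j\<in>I. a j * X j \<omega>)) \<partial>M) =
    ennreal (exp (\<sigma>\<^sup>2 / 2 * (\<Sum>j\<in>I. (a j)\<^sup>2)))"
proof -
  have "indep_vars (\<lambda>_. borel) (\<lambda>j \<omega>. ennreal (exp (a j * X j \<omega>))) I"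
    by (rule indep_vars_compose2[OF ind]) measurable
  from indep_vars_nn_integral[OF assms(1) this]
  have "(\<integral>\<^sup>+\<omega>. ennreal (exp (\<Sum>j\<in>I. a j * X j \<omega>)) \<partial>M) =
      (\<Prod>j\<in>I. \<integral>\<^sup>+\<omega>. ennreal (exp (a j * X j \<omega>)) \<partial>M)"
    by (simp add: exp_sum assms(1) prod_ennreal)
  also have "\<dots> = (\<Prod>j\<in>I. ennreal (exp (\<sigma>\<^sup>2 / 2 * (a j)\<^sup>2)))"
    by (intro prod.cong refl) (simp add: nn_integral_exp_normal[OF assms(4,3)] mult.commute)
  also have "\<dots> = ennreal (exp (\<sigma>\<^sup>2 / 2 * (\<Sum>j\<in>I. (a j)\<^sup>2)))"
    by (simp add: prod_ennreal exp_sum assms(1) sum_distrib_left)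
  finally show ?thesis .
qed

text \<open>Markov's inequality for an exponential moment: on the event, the product of
  \<open>exp (l * (c - b))\<close> and
  \<open>exp (- l * (\<Sum>j\<in>I. a j * X j \<omega>))\<close> is at least 1. The parameter
  \<open>l\<close> stays free so that it can be optimised later.\<close>

lemma (in prob_space) chernoff_lower_tail_indep_normal:
  fixes \<sigma> b l c :: real and a :: "'i \<Rightarrow> real"
  assumes "finite I" and ind: "indep_vars (\<lambda>_. borel) X I" and "\<sigma> > 0"
    and "\<And>j. j \<in> I \<Longrightarrow> distributed M lborel (X j) (\<lambda>x. ennreal (normal_density 0 \<sigma> x))"
    and "l \<ge> 0"
  shows "{\<omega> \<in> space M. b + (\<Sum>j\<in>I. a j * X j \<omega>) \<le> c} \<in> sets M"
    and "measure M {\<omega> \<in> space M. b + (\<Sum>j\<in>I. a j * X j \<omega>) \<le> c} \<le>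
      exp (l * (c - b) + l\<^sup>2 * \<sigma>\<^sup>2 / 2 * (\<Sum>j\<in>I. (a j)\<^sup>2))"
proof -
  have rv[measurable]: "X j \<in> borel_measurable M" if "j \<in> I" for j
    using ind that by (auto simp: indep_vars_def)
  let ?A = "{\<omega> \<in> space M. b + (\<Sum>j\<in>I. a j * X j \<omega>) \<le> c}"
  show A: "?A \<in> sets M"
    by measurable
  let ?Z = "\<lambda>\<omega>. \<Sum>j\<in>I. - l * a j * X j \<omega>"
  have Z: "?Z \<omega> = - l * (\<Sum>j\<in>I. a j * X j \<omega>)" for \<omega>
    by (simp add: sum_distrib_left mult.assoc sum_negf)
  have "emeasure M ?A = (\<integral>\<^sup>+\<omega>. indicator ?A \<omega> \<partial>M)"
    using A by simp
  also have "\<dots> \<le> (\<integral>\<^sup>+\<omega>. ennreal (exp (l * (c - b))) * ennreal (exp (?Z \<omega>)) \<partial>M)"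
  proof (rule nn_integral_mono)
    fix \<omega>
    show "indicator ?A \<omega> \<le> ennreal (exp (l * (c - b))) * ennreal (exp (?Z \<omega>))"
    proof (cases "\<omega> \<in> ?A")
      case True
      then have "0 \<le> l * (c - b - (\<Sum>j\<in>I. a j * X j \<omega>))"
        using assms(5) by (intro mult_nonneg_nonneg) auto
      then have "0 \<le> l * (c - b) + ?Z \<omega>"
        unfolding Z by (simp add: algebra_simps)
      then show ?thesis
        using True by (simp add: ennreal_mult[symmetric] exp_add[symmetric])
    qed auto
  qed
  also have "\<dots> = ennreal (exp (l * (c - b))) * (\<integral>\<^sup>+\<omega>. ennreal (exp (?Z \<omega>)) \<partial>M)"
    by (rule nn_integral_cmult) measurable
  also have "(\<integral>\<^sup>+\<omega>. ennreal (exp (?Z \<omega>)) \<partial>M) =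
      ennreal (exp (\<sigma>\<^sup>2 / 2 * (\<Sum>j\<in>I. (- l * a j)\<^sup>2)))"
    using nn_integral_exp_sum_indep_normal[OF assms(1-4), of "\<lambda>j. - l * a j"] by simp
  also have "(\<Sum>j\<in>I. (- l * a j)\<^sup>2) = l\<^sup>2 * (\<Sum>j\<in>I. (a j)\<^sup>2)"
    by (simp add: power_mult_distrib sum_distrib_left)
  finally have "emeasure M ?A \<le>
      ennreal (exp (l * (c - b) + l\<^sup>2 * \<sigma>\<^sup>2 / 2 * (\<Sum>j\<in>I. (a j)\<^sup>2)))"
    by (simp add: ennreal_mult[symmetric] exp_add ac_simps)
  then show "measure M ?A \<le> exp (l * (c - b) + l\<^sup>2 * \<sigma>\<^sup>2 / 2 * (\<Sum>j\<in>I. (a j)\<^sup>2))"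
    by (simp add: emeasure_eq_measure)
qed

section \<open>Iterates of the consensus matrix\<close>

lemma inner_symmetric_matrix:
  fixes W :: "real^'n^'n"
  assumes "transpose W = W"
  shows "x \<bullet> (W *v y) = (W *v x) \<bullet> y"
  by (metis assms dot_lmul_matrix transpose_matrix_vector)

text \<open>By symmetry, each step of the recursion moves one factor \<open>W\<close> onto the test
  vector, so the induction needs \<open>v\<close> arbitrary. The input at time \<open>s\<close> has
  passed through \<open>W\<close> exactly \<open>Suc t - s\<close> times, hence at least
  once.\<close>

lemma inner_dist_stat:
  fixes W :: "real^'n^'n"
  assumes "transpose W = W"
  shows "v \<bullet> dist_stat W \<eta> t \<omega> = (\<Sum>s\<in>{1..t}. (((*v) W ^^ (Suc t - s)) v) \<bullet> \<eta> s \<omega>)"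
proof (induction t arbitrary: v)
  case (Suc t)
  have "v \<bullet> dist_stat W \<eta> (Suc t) \<omega> = (W *v v) \<bullet> dist_stat W \<eta> t \<omega> + (W *v v) \<bullet> \<eta> (Suc t) \<omega>"
    by (simp add: inner_symmetric_matrix[OF assms] inner_add_right)
  also have "(W *v v) \<bullet> dist_stat W \<eta> t \<omega> =
      (\<Sum>s\<in>{1..t}. (((*v) W ^^ (Suc (Suc t) - s)) v) \<bullet> \<eta> s \<omega>)"
    unfolding Suc.IH
    by (intro sum.cong refl) (simp add: Suc_diff_le funpow_swap1)
  finally show ?case by simp
qed simp

lemma averaging_matrix_mult:
  fixes x :: "real^'n"
  shows "averaging_matrix *v x = (\<chi> i. (\<Sum>j\<in>UNIV. x $ j) / real CARD('n))"
  by (simp add: averaging_matrix_def matrix_vector_mult_def sum_divide_distrib)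

text \<open>The sum of the entries is the inner product with the all-ones vector, which a symmetric
  stochastic \<open>W\<close> fixes.\<close>

lemma sum_consensus_iterate:
  fixes W :: "real^'n^'n"
  assumes "transpose W = W" and "\<And>i. (\<Sum>j\<in>UNIV. W $ i $ j) = 1"
  shows "(\<Sum>j\<in>UNIV. (((*v) W ^^ n) v) $ j) = (\<Sum>j\<in>UNIV. v $ j)"
proof -
  have one: "W *v 1 = 1"
    by (simp add: vec_eq_iff matrix_vector_mult_def assms(2))
  have sum_one: "(\<Sum>j\<in>UNIV. x $ j) = 1 \<bullet> x" for x :: "real^'n"
    by (simp add: inner_vec_def)
  have "1 \<bullet> (((*v) W ^^ n) v) = 1 \<bullet> v"
    by (induction n) (simp_all add: inner_symmetric_matrix[OF assms(1)] one)
  then show ?thesis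
    by (simp add: sum_one)
qed

text \<open>The deviation of \<open>u n\<close> from the uniform vector has entries summing to zero.
  Averaging therefore kills it, and \<open>W\<close> acts on it as
  \<open>W - averaging_matrix\<close>, which stretches norms by at most \<open>r\<close>. It is also
  orthogonal to the uniform vector, whose squared norm is the first summand.\<close>

lemma norm_consensus_iterate:
  fixes W :: "real^'n^'n" and v :: "real^'n"
  defines "r \<equiv> onorm ((*v) (W - averaging_matrix))" and "u \<equiv> \<lambda>n. ((*v) W ^^ n) v"
  assumes sym: "transpose W = W" and row: "\<And>i. (\<Sum>j\<in>UNIV. W $ i $ j) = 1"
    and v: "(\<Sum>j\<in>UNIV. v $ j) = 1"
  shows "(norm (u n))\<^sup>2 \<le> 1 / real CARD('n) + (r\<^sup>2) ^ n * (norm (v - (\<chi> i. 1 / real CARD('n))))\<^sup>2"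
proof -
  let ?c = "(\<chi> i. 1 / real CARD('n)) :: real^'n"
  have bl: "bounded_linear ((*v) (W - averaging_matrix))"
    by (simp add: linear_linear)
  have Wc: "W *v ?c = ?c"
    by (simp add: vec_eq_iff matrix_vector_mult_def sum_divide_distrib[symmetric] row)
  have sum_u: "(\<Sum>j\<in>UNIV. u n $ j) = 1" for n
    unfolding u_def by (simp only: sum_consensus_iterate[OF sym row] v)
  have Jd: "averaging_matrix *v (u n - ?c) = 0" for n
    by (simp add: averaging_matrix_mult sum_subtractf sum_u vec_eq_iff)
  have step: "u (Suc n) - ?c = (W - averaging_matrix) *v (u n - ?c)" for n
    by (simp add: matrix_vector_mult_diff_rdistrib Jd)
      (simp add: u_def matrix_vector_mult_diff_distrib Wc)
  have decay: "norm (u n - ?c) \<le> r ^ n * norm (v - ?c)" for n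
  proof (induction n)
    case (Suc n)
    have "norm (u (Suc n) - ?c) \<le> r * norm (u n - ?c)"
      unfolding step r_def by (rule onorm[OF bl])
    also have "\<dots> \<le> r * (r ^ n * norm (v - ?c))"
      using Suc onorm_pos_le[OF bl] by (intro mult_left_mono) (auto simp: r_def)
    finally show ?case by (simp add: mult.assoc)
  qed (simp add: u_def)
  have orth: "(u n - ?c) \<bullet> ?c = 0"
    by (simp add: inner_vec_def sum_subtractf sum_u sum_divide_distrib[symmetric] sum_distrib_right[symmetric])
  have "(norm (u n))\<^sup>2 = (norm ((u n - ?c) + ?c))\<^sup>2"
    by simp
  also have "\<dots> = (norm (u n - ?c))\<^sup>2 + (norm ?c)\<^sup>2"
    using orth by (intro norm_add_Pythagorean) (simp add: orthogonal_def)
  also have "(norm ?c)\<^sup>2 = 1 / real CARD('n)"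
    by (simp add: power2_norm_eq_inner inner_vec_def)
  also have "(norm (u n - ?c))\<^sup>2 \<le> (r ^ n * norm (v - ?c))\<^sup>2"
    by (intro power_mono decay) simp
  also have "(r ^ n * norm (v - ?c))\<^sup>2 = (r\<^sup>2) ^ n * (norm (v - ?c))\<^sup>2"
    by (simp add: power_mult_distrib power_mult[symmetric] mult.commute)
  finally show ?thesis by simp
qed

section \<open>From exponential bounds to asymptotic rates\<close>

lemma limsup_elog_le:
  fixes p :: "nat \<Rightarrow> real" and c d :: real
  assumes "\<And>t. p t \<le> exp (c + d * real t)"
  shows "limsup (\<lambda>t. ereal (1 / real t) * elog (p t)) \<le> ereal d"
proof -
  \<comment> \<open>For \<open>t > 0\<close> the factor is positive, so a value
    \<open>-\<infinity>\<close> of \<open>elog\<close> survives the product; at \<open>t = 0\<close>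
    the factor would be 0 and the product 0.\<close>
  have "ereal (1 / real t) * elog (p t) \<le> ereal (c / real t + d)" if "t > 0" for t
  proof (cases "p t \<le> 0")
    case False
    then have "ln (p t) \<le> c + d * real t"
      using assms[of t] by (metis ln_exp ln_mono exp_gt_zero not_le)
    then have "1 / real t * ln (p t) \<le> c / real t + d"
      using that by (simp add: field_simps)
    then show ?thesis
      using False by (simp add: elog_def)
  qed (use that in \<open>simp add: elog_def\<close>)
  then have "limsup (\<lambda>t. ereal (1 / real t) * elog (p t)) \<le> limsup (\<lambda>t. ereal (c / real t + d))"
    by (intro Limsup_mono) (auto simp: eventually_sequentially intro: exI[of _ 1])
  also have "\<dots> = ereal d"
  proof (intro lim_imp_Limsup)
    have "(\<lambda>t. c / real t + d) \<longlonglongrightarrow> 0 + d"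
      by (intro tendsto_add tendsto_const lim_const_over_n)
    then show "(\<lambda>t. ereal (c / real t + d)) \<longlonglongrightarrow> ereal d"
      by simp
  qed simp
  finally show ?thesis .
qed

section \<open>Decay rate of the tail of the stopping time\<close>

theorem theorem4p6:
  fixes P :: "nat \<Rightarrow> 'a measure"
    and y :: "'n::finite \<Rightarrow> nat \<Rightarrow> 'a \<Rightarrow> real"
    and E :: "('n \<times> 'n) set"
    and W :: "real^'n^'n"
    and \<mu> \<sigma> m N r k \<alpha> \<beta> :: real
    and \<gamma>l \<gamma>h :: "'n \<Rightarrow> real"
  assumes "\<mu> \<noteq> 0" and "\<sigma> > 0"
    and "gaussian_observations P \<mu> \<sigma> y"
    and "connected_simple_graph E"
    and "consensus_weights E W"
    and "N = real CARD('n)"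
    and "m = 2 * \<mu>\<^sup>2 / \<sigma>\<^sup>2"
    and "r = onorm ((*v) (W - averaging_matrix))"
    and "r < 1"
    and "k = N * r\<^sup>2"
    and "\<alpha> \<in> {0<..<1/2}" and "\<beta> \<in> {0<..<1/2}"
    and "\<forall>i. \<gamma>h i \<ge> 8 * (k + 1) / (7 * N) *
               (ln (2 / \<alpha>) - ln (1 - exp (- (N * m / (4 * (k + 1))))))"
    and "\<forall>i. \<gamma>l i \<le> 8 * (k + 1) / (7 * N) *
               (ln (\<beta> / 2) + ln (1 - exp (- (N * m / (4 * (k + 1))))))"
  shows "\<forall>i. limsup (\<lambda>t. ereal (1 / real t) *
               elog (measure (P 1) {\<omega> \<in> space (P 1).
                 agent_stopping_time (dist_stat W (llr \<mu> \<sigma> y)) \<gamma>l \<gamma>h i \<omega> > enat t}))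
             \<le> ereal (- (N * m / 4))"
proof
  fix i :: 'n
  interpret prob_space "P 1"
    using assms(3) by (simp add: gaussian_observations_def)
  define n where "n = (\<lambda>(j, s) \<omega>. y j s \<omega> - \<mu>)"
  let ?I = "\<lambda>t::nat. (UNIV :: 'n set) \<times> {1..t}"
  have "indep_vars (\<lambda>_. borel) n (UNIV \<times> {1..})"
    using assms(3) by (simp add: gaussian_observations_def hyp_mean_def n_def)
  then have ind: "indep_vars (\<lambda>_. borel) n (?I t)" for t
    by (rule indep_vars_subset) auto
  have distr: "distributed (P 1) lborel (n p) (\<lambda>x. ennreal (normal_density 0 \<sigma> x))"
    if "p \<in> ?I t" for p t
    using assms(3) that by (auto simp: gaussian_observations_def hyp_mean_def n_def)
  have sym: "transpose W = W" and row: "\<And>i. (\<Sum>j\<in>UNIV. W $ i $ j) = 1"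
    using assms(5) by (auto simp: consensus_weights_def)
  have N: "N > 0"
    by (simp add: assms(6))
  have m: "m > 0"
    using assms(1,2) by (simp add: assms(7))
  have r: "0 \<le> r\<^sup>2" "r\<^sup>2 < 1"
  proof -
    have "0 \<le> r"
      unfolding assms(8) by (rule onorm_pos_le) (simp add: linear_linear)
    with \<open>r < 1\<close> show "r\<^sup>2 < 1"
      by (simp add: power_less_one_iff)
  qed simp
  let ?S = "dist_stat W (llr \<mu> \<sigma> y)"
  define e where "e = (axis i 1 :: real^'n)"
  define D where "D = (norm (e - (\<chi> i. 1 / real CARD('n))))\<^sup>2"
  define u where "u = (\<lambda>s. ((*v) W ^^ s) e)"
  have sum_e: "(\<Sum>j\<in>UNIV. e $ j) = 1"
    by (simp add: e_def axis_def)
  have sum_u: "(\<Sum>j\<in>UNIV. u s $ j) = 1" for s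
    unfolding u_def by (simp only: sum_consensus_iterate[OF sym row] sum_e)
  have norm_u: "(norm (u s))\<^sup>2 \<le> 1 / N + (r\<^sup>2) ^ s * D" for s
    using norm_consensus_iterate[OF sym row sum_e, of s]
    by (simp add: u_def D_def assms(6,8))
  \<comment> \<open>The coefficient of the noise \<open>n (j, s)\<close> in the statistic of agent
    \<open>i\<close> at time \<open>t\<close>.\<close>
  define a where "a = (\<lambda>t (j, s). 2 * \<mu> / \<sigma>\<^sup>2 * u (Suc t - s) $ j)"
  have stat: "?S t \<omega> $ i = m * real t + (\<Sum>p\<in>?I t. a t p * n p \<omega>)" for t \<omega>
  proof -
    have llr: "llr \<mu> \<sigma> y s \<omega> $ j = m + 2 * \<mu> / \<sigma>\<^sup>2 * n (j, s) \<omega>" for j s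
      using assms(2) by (simp add: llr_def n_def assms(7) field_simps power2_eq_square)
    have "?S t \<omega> $ i = e \<bullet> ?S t \<omega>"
      by (simp add: e_def inner_axis')
    also have "\<dots> = (\<Sum>s\<in>{1..t}. u (Suc t - s) \<bullet> llr \<mu> \<sigma> y s \<omega>)"
      by (simp add: inner_dist_stat[OF sym] u_def)
    also have "\<dots> = (\<Sum>s\<in>{1..t}. \<Sum>j\<in>UNIV. m * u (Suc t - s) $ j + a t (j, s) * n (j, s) \<omega>)"
      by (simp add: inner_vec_def llr a_def algebra_simps)
    also have "\<dots> = m * real t + (\<Sum>s\<in>{1..t}. \<Sum>j\<in>UNIV. a t (j, s) * n (j, s) \<omega>)"
      by (simp add: sum.distrib sum_distrib_left[symmetric] sum_u)
    also have "(\<Sum>s\<in>{1..t}. \<Sum>j\<in>UNIV. a t (j, s) * n (j, s) \<omega>) = (\<Sum>p\<in>?I t. a t p * n p \<omega>)"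
      by (subst sum.swap) (simp add: sum.cartesian_product case_prod_unfold)
    finally show ?thesis .
  qed
  \<comment> \<open>The left side is half the variance of the statistic. The factor \<open>m\<close>
    arises as \<open>\<sigma>\<^sup>2 / 2\<close> times the square of
    \<open>2 * \<mu> / \<sigma>\<^sup>2\<close>.\<close>
  have var: "\<sigma>\<^sup>2 / 2 * (\<Sum>p\<in>?I t. (a t p)\<^sup>2) \<le> m * (real t / N + D / (1 - r\<^sup>2))" for t
  proof -
    have "(\<Sum>p\<in>?I t. (a t p)\<^sup>2) = (\<Sum>s\<in>{1..t}. \<Sum>j\<in>UNIV. (a t (j, s))\<^sup>2)"
      by (subst sum.swap) (simp add: sum.cartesian_product case_prod_unfold)
    also have "\<dots> = (2 * \<mu> / \<sigma>\<^sup>2)\<^sup>2 * (\<Sum>s\<in>{1..t}. (norm (u (Suc t - s)))\<^sup>2)"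
      unfolding a_def power2_norm_eq_inner inner_vec_def
      by (simp add: power_mult_distrib sum_distrib_left power2_eq_square ac_simps)
    also have "(\<Sum>s\<in>{1..t}. (norm (u (Suc t - s)))\<^sup>2) = (\<Sum>s\<in>{1..t}. (norm (u s))\<^sup>2)"
      by (rule sum.reindex_bij_witness[of _ "\<lambda>s. Suc t - s" "\<lambda>s. Suc t - s"]) auto
    finally have "\<sigma>\<^sup>2 / 2 * (\<Sum>p\<in>?I t. (a t p)\<^sup>2) = m * (\<Sum>s\<in>{1..t}. (norm (u s))\<^sup>2)"
      using assms(2) by (simp add: assms(7) field_simps power2_eq_square)
    also have "(\<Sum>s\<in>{1..t}. (norm (u s))\<^sup>2) \<le> (\<Sum>s\<in>{1..t}. 1 / N + (r\<^sup>2) ^ s * D)"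
      by (intro sum_mono norm_u)
    also have "\<dots> = real t / N + (\<Sum>s\<in>{1..t}. (r\<^sup>2) ^ s) * D"
      by (simp add: sum.distrib sum_distrib_right)
    \<comment> \<open>The full geometric series bounds the excess over perfect averaging uniformly
      in \<open>t\<close>; this is where \<open>r < 1\<close> enters.\<close>
    also have "(\<Sum>s\<in>{1..t}. (r\<^sup>2) ^ s) * D \<le> 1 / (1 - r\<^sup>2) * D"
    proof (rule mult_right_mono)
      have "(\<Sum>s\<in>{1..t}. (r\<^sup>2) ^ s) \<le> (\<Sum>s. (r\<^sup>2) ^ s)"
        using r by (intro sum_le_suminf summable_geometric) auto
      then show "(\<Sum>s\<in>{1..t}. (r\<^sup>2) ^ s) \<le> 1 / (1 - r\<^sup>2)"
        using r by (simp add: suminf_geometric)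
    qed (simp add: D_def)
    finally show ?thesis
      using m by simp
  qed
  \<comment> \<open>The absolute value makes the bound valid at \<open>t = 0\<close> as well, where the statistic is zero.\<close>
  define C where "C = N / 2 * \<bar>\<gamma>h i\<bar> + (N / 2)\<^sup>2 * m * (D / (1 - r\<^sup>2))"
  let ?T = "agent_stopping_time ?S \<gamma>l \<gamma>h i"
  have bound: "measure (P 1) {\<omega> \<in> space (P 1). ?T \<omega> > enat t} \<le> exp (C + - (N * m / 4) * real t)"
    for t
  proof -
    let ?A = "{\<omega> \<in> space (P 1). m * real t + (\<Sum>p\<in>?I t. a t p * n p \<omega>) \<le> \<bar>\<gamma>h i\<bar>}"
    have "?S t \<omega> $ i \<le> \<bar>\<gamma>h i\<bar>" if "?T \<omega> > enat t" for \<omega>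
    proof (cases "t = 0")
      case False
      \<comment> \<open>Otherwise \<open>t\<close> itself would be an exit time, and the infimum
        could not exceed it.\<close>
      have "?S t \<omega> $ i \<in> {\<gamma>l i..\<gamma>h i}"
      proof (rule ccontr)
        assume "?S t \<omega> $ i \<notin> {\<gamma>l i..\<gamma>h i}"
        with False have "?T \<omega> \<le> enat t"
          unfolding agent_stopping_time_def by (intro Inf_lower) auto
        with that show False by simp
      qed
      then show ?thesis by auto
    qed simp
    then have "{\<omega> \<in> space (P 1). ?T \<omega> > enat t} \<subseteq> ?A"
      by (auto simp: stat)
    \<comment> \<open>Monotonicity asks for measurability of the larger event \<open>?A\<close>,
      which the first part of the Chernoff lemma supplies.\<close>
    then have "measure (P 1) {\<omega> \<in> space (P 1). ?T \<omega> > enat t} \<le> measure (P 1) ?A"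
      by (intro finite_measure_mono
          chernoff_lower_tail_indep_normal(1)[OF _ ind assms(2) distr order_refl]) auto
    \<comment> \<open>The choice \<open>l = N / 2\<close> minimises the part of the exponent linear
      in \<open>t\<close>, namely \<open>- l * m * t + l\<^sup>2 * m * t / N\<close>; the minimum is
      \<open>- N * m * t / 4\<close>.\<close>
    also have "\<dots> \<le> exp (N / 2 * (\<bar>\<gamma>h i\<bar> - m * real t) +
        (N / 2)\<^sup>2 * \<sigma>\<^sup>2 / 2 * (\<Sum>p\<in>?I t. (a t p)\<^sup>2))"
      using N by (intro chernoff_lower_tail_indep_normal(2)[OF _ ind assms(2) distr]) auto
    also have "\<dots> \<le> exp (C + - (N * m / 4) * real t)"
    proof -
      have "(N / 2)\<^sup>2 * \<sigma>\<^sup>2 / 2 * (\<Sum>p\<in>?I t. (a t p)\<^sup>2) =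
          (N / 2)\<^sup>2 * (\<sigma>\<^sup>2 / 2 * (\<Sum>p\<in>?I t. (a t p)\<^sup>2))"
        by simp
      also have "\<dots> \<le> (N / 2)\<^sup>2 * (m * (real t / N + D / (1 - r\<^sup>2)))"
        by (intro mult_left_mono var) simp
      also have "\<dots> = N * m / 4 * real t + (N / 2)\<^sup>2 * m * (D / (1 - r\<^sup>2))"
        using N by (simp add: power2_eq_square distrib_left)
      \<comment> \<open>Written as twice \<open>N * m / 4 * real t\<close>, the gain from the mean
        visibly exceeds the variance term by one copy, and the rest is linear arithmetic.\<close>
      moreover have "N / 2 * (\<bar>\<gamma>h i\<bar> - m * real t) = N / 2 * \<bar>\<gamma>h i\<bar> - 2 * (N * m / 4 * real t)"
        by (simp add: algebra_simps)
      ultimately show ?thesis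
        unfolding exp_le_cancel_iff C_def by linarith
    qed
    finally show ?thesis .
  qed
  then show "limsup (\<lambda>t. ereal (1 / real t) *
      elog (measure (P 1) {\<omega> \<in> space (P 1). ?T \<omega> > enat t})) \<le> ereal (- (N * m / 4))"
    by (rule limsup_elog_le)
qed

end
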